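(* Let $G=(V,w,\mu)$ be a finite connected weighted graph with non-negative Bakry-Émery curvature. Then $\beta_1(M_2^{\mathrm{path}}(G))\le\deg_{\min}-1$.
   Context: $V$ finite, $w:V\times V\to[0,\infty)$ symmetric vanishing on the diagonal, $\mu:V\to(0,\infty)$, $x\sim y$ iff $w(x,y)>0$, $G$ connected; $\deg(x)=|\{y:y\sim x\}|$, $\deg_{\min}=\min_x\deg(x)$. Laplacian $\Delta f(x)=\sum_y\frac{w(x,y)}{\mu(x)}(f(y)-f(x))$. $\Gamma(f,g)=\frac12(\Delta(fg)-f\Delta g-g\Delta f)$, $\Gamma_2(f,g)=\frac12(\Delta\Gamma(f,g)-\Gamma(f,\Delta g)-\Gamma(g,\Delta f))$, $\Gamma(f)=\Gamma(f,f)$, $\Gamma_2(f)=\Gamma_2(f,f)$. A vertex $x$ satisfies $CD(K,N,x)$ ($K\in\mathbb R$, $N\in(0,\infty]$) if $\Gamma_2(f)(x)\ge\frac1N(\Delta f(x))^2+K\Gamma(f)(x)$ for all $f$; $G$ has non-negative Bakry-Émery curvature if it satisfies $CD(K,N,x)$ at all $x$ for some $K\ge0$ and $N\in(0,\infty]$. $M_2^{\mathrm{path}}(G)$: 1-forms are antisymmetric functions $\alpha(x,y)=-\alpha(y,x)$ on ordered adjacent pairs; its 2-cells are all cycles $(x_0\sim\dots\sim x_{n-1})$ of distinct vertices with $n\in\{3,4\}$ and $x_{n-1}\sim x_0$; $\delta\alpha(c)=\sum_i\alpha(x_i,x_{i+1\bmod n})$; $\delta^*\alpha(x)=\sum_y\frac{w(x,y)}{\mu(x)}\alpha(x,y)$;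 $H_1(M_2^{\mathrm{path}}(G))=\{\alpha:\delta\alpha=0\text{ on all such cycles},\ \delta^*\alpha\equiv0\}$ and $\beta_1=\dim H_1$.
   Formalization: For the one-vertex graph (deg_min = 0, β₁ = 0) the stated bound 0 ≤ −1 fails; the formal version reads deg_min − 1 as max(deg_min − 1, 0), which changes nothing for graphs with at least two vertices. *)

theory Defs
  imports "HOL-Analysis.Analysis"
begin

locale weighted_graph =
  fixes w :: "'v::finite \<Rightarrow> 'v \<Rightarrow> real" and \<mu> :: "'v \<Rightarrow> real"
  assumes w_nonneg: "0 \<le> w x y"
    and w_sym: "w x y = w y x"
    and w_diag: "w x x = 0"
    and \<mu>_pos: "0 < \<mu> x"

definition adj :: "('v \<Rightarrow> 'v \<Rightarrow> real) \<Rightarrow> 'v \<Rightarrow> 'v \<Rightarrow> bool" where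
  "adj w x y \<longleftrightarrow> w x y > 0"

definition graph_connected :: "('v \<Rightarrow> 'v \<Rightarrow> real) \<Rightarrow> bool" where
  "graph_connected w \<longleftrightarrow> (\<forall>x y. (adj w)\<^sup>*\<^sup>* x y)"

definition vdeg :: "('v \<Rightarrow> 'v \<Rightarrow> real) \<Rightarrow> 'v \<Rightarrow> nat" where
  "vdeg w x = card {y. adj w y x}"

text \<open>A connected graph has \<open>deg_min w \<ge> 1\<close> unless it consists of a single vertex. Hence
  \<open>deg_min w - 1\<close> on \<open>nat\<close> is ordinary subtraction except for the one-vertex graph, where
  it is \<open>0\<close>.\<close>
definition deg_min :: "('v \<Rightarrow> 'v \<Rightarrow> real) \<Rightarrow> nat" where
  "deg_min w = Min (range (vdeg w))"

definition laplacian ::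
    "('v::finite \<Rightarrow> 'v \<Rightarrow> real) \<Rightarrow> ('v \<Rightarrow> real) \<Rightarrow> ('v \<Rightarrow> real) \<Rightarrow> 'v \<Rightarrow> real" where
  "laplacian w \<mu> f x = (\<Sum>y\<in>UNIV. w x y / \<mu> x * (f y - f x))"

definition Gamma_form :: "('v::finite \<Rightarrow> 'v \<Rightarrow> real) \<Rightarrow> ('v \<Rightarrow> real) \<Rightarrow>
    ('v \<Rightarrow> real) \<Rightarrow> ('v \<Rightarrow> real) \<Rightarrow> 'v \<Rightarrow> real" where
  "Gamma_form w \<mu> f g x = 1 / 2 *
     (laplacian w \<mu> (\<lambda>y. f y * g y) x - f x * laplacian w \<mu> g x - g x * laplacian w \<mu> f x)"

definition Gamma2_form :: "('v::finite \<Rightarrow> 'v \<Rightarrow> real) \<Rightarrow> ('v \<Rightarrow> real) \<Rightarrow>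
    ('v \<Rightarrow> real) \<Rightarrow> ('v \<Rightarrow> real) \<Rightarrow> 'v \<Rightarrow> real" where
  "Gamma2_form w \<mu> f g x = 1 / 2 *
     (laplacian w \<mu> (Gamma_form w \<mu> f g) x
      - Gamma_form w \<mu> f (laplacian w \<mu> g) x
      - Gamma_form w \<mu> g (laplacian w \<mu> f) x)"

text \<open>The dimension parameter \<open>N\<close> is meant to range over \<open>(0, \<infinity>]\<close>; in \<open>ereal\<close> one has
  \<open>1 / \<infinity> = 0\<close>, so the term \<open>(\<Delta> f)\<^sup>2 / N\<close> disappears for \<open>N = \<infinity>\<close>.\<close>
definition CD :: "('v::finite \<Rightarrow> 'v \<Rightarrow> real) \<Rightarrow> ('v \<Rightarrow> real) \<Rightarrow> real \<Rightarrow> ereal \<Rightarrow> 'v \<Rightarrow> bool" where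
  "CD w \<mu> K N x \<longleftrightarrow> (\<forall>f. Gamma2_form w \<mu> f f x \<ge>
     real_of_ereal (1 / N) * (laplacian w \<mu> f x)\<^sup>2 + K * Gamma_form w \<mu> f f x)"

definition nonneg_BE_curvature ::
    "('v::finite \<Rightarrow> 'v \<Rightarrow> real) \<Rightarrow> ('v \<Rightarrow> real) \<Rightarrow> bool" where
  "nonneg_BE_curvature w \<mu> \<longleftrightarrow>
     (\<exists>K::real. \<exists>N::ereal. K \<ge> 0 \<and> N > 0 \<and> (\<forall>x. CD w \<mu> K N x))"

text \<open>A function on ordered adjacent pairs is encoded as a matrix whose entries vanish at all
  non-adjacent pairs, so that \<open>dim\<close> gives the dimension of a space of 1-forms.\<close>
definition one_forms :: "('v::finite \<Rightarrow> 'v \<Rightarrow> real) \<Rightarrow> (real ^ 'v ^ 'v) set" where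
  "one_forms w = {\<alpha>. (\<forall>x y. adj w x y \<longrightarrow> \<alpha> $ x $ y = - \<alpha> $ y $ x) \<and>
                     (\<forall>x y. \<not> adj w x y \<longrightarrow> \<alpha> $ x $ y = 0)}"

definition path_2cells :: "('v \<Rightarrow> 'v \<Rightarrow> real) \<Rightarrow> 'v list set" where
  "path_2cells w = {c. length c \<in> {3, 4} \<and> distinct c \<and>
     (\<forall>i<length c. adj w (c ! i) (c ! (Suc i mod length c)))}"

definition coboundary :: "real ^ 'v ^ 'v \<Rightarrow> 'v::finite list \<Rightarrow> real" where
  "coboundary \<alpha> c = (\<Sum>i<length c. \<alpha> $ (c ! i) $ (c ! (Suc i mod length c)))"

definition codifferential ::
    "('v::finite \<Rightarrow> 'v \<Rightarrow> real) \<Rightarrow> ('v \<Rightarrow> real) \<Rightarrow> real ^ 'v ^ 'v \<Rightarrow> 'v \<Rightarrow> real" where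
  "codifferential w \<mu> \<alpha> x = (\<Sum>y\<in>UNIV. w x y / \<mu> x * \<alpha> $ x $ y)"

definition H1_path ::
    "('v::finite \<Rightarrow> 'v \<Rightarrow> real) \<Rightarrow> ('v \<Rightarrow> real) \<Rightarrow> (real ^ 'v ^ 'v) set" where
  "H1_path w \<mu> = {\<alpha> \<in> one_forms w.
     (\<forall>c\<in>path_2cells w. coboundary \<alpha> c = 0) \<and> (\<forall>x. codifferential w \<mu> \<alpha> x = 0)}"

lemma subspace_H1_path: "subspace (H1_path w \<mu>)"
proof -
  have [simp]: "coboundary 0 c = 0" "coboundary (\<alpha> + \<beta>) c = coboundary \<alpha> c + coboundary \<beta> c"
    "coboundary (r *\<^sub>R \<alpha>) c = r * coboundary \<alpha> c" for r c and \<alpha> \<beta> :: "real ^ 'a ^ 'a"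
    by (simp_all add: coboundary_def sum.distrib sum_distrib_left)
  have [simp]: "codifferential w \<mu> 0 x = 0"
    "codifferential w \<mu> (\<alpha> + \<beta>) x = codifferential w \<mu> \<alpha> x + codifferential w \<mu> \<beta> x"
    "codifferential w \<mu> (r *\<^sub>R \<alpha>) x = r * codifferential w \<mu> \<alpha> x" for r x \<alpha> \<beta>
    by (simp_all add: codifferential_def sum.distrib sum_distrib_left algebra_simps)
  show ?thesis
    unfolding subspace_def H1_path_def one_forms_def by auto
qed

definition betti1_path :: "('v::finite \<Rightarrow> 'v \<Rightarrow> real) \<Rightarrow> ('v \<Rightarrow> real) \<Rightarrow> nat" where
  "betti1_path w \<mu> = dim (H1_path w \<mu>)"

end

theory Submission
  imports Defs
begin

text \<open>A 1-form \<open>\<alpha>\<close> that is closed on triangles and 4-cycles is, on the edges meeting the unit ball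
  around a vertex, the differential of a function \<open>f\<close>, and if \<open>\<alpha>\<close> is coclosed then \<open>f\<close> is harmonic
  on that ball. Hence \<open>\<Gamma>\<^sub>2(f)\<close> is half the Laplacian of the pointwise energy of \<open>\<alpha>\<close> at the centre, so
  under non-negative curvature the energy is subharmonic and therefore constant. So \<open>\<alpha>\<close> is
  determined by its values on the edges at a single vertex \<open>x\<close>, and these satisfy one nontrivial
  linear relation, the vanishing of the codifferential at \<open>x\<close>.\<close>

lemma dim_subspace_orthogonal_to_vector:
  fixes c :: "'a::euclidean_space"
  assumes "subspace L" "c \<in> L"
  shows "dim {v \<in> L. orthogonal c v} + dim {c} = dim L"
proof -
  have "span {c} \<subseteq> L"
    using assms by (intro span_minimal) auto
  then have "dim {v \<in> L. \<forall>u\<in>span {c}. orthogonal u v} + dim (span {c}) = dim L"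
    using assms(1) by (intro dim_subspace_orthogonal_to_vectors subspace_span)
  moreover have "(\<forall>u\<in>span {c}. orthogonal u v) \<longleftrightarrow> orthogonal c v" for v
    by (metis orthogonal_commute orthogonal_to_span singletonD singletonI span_base)
  ultimately show ?thesis
    by simp
qed

lemma dim_orthogonal_in_support:
  fixes c :: "real ^ 'n"
  shows "dim {v. (\<forall>i. c $ i = 0 \<longrightarrow> v $ i = 0) \<and> orthogonal c v} = card {i. c $ i \<noteq> 0} - 1"
proof -
  define L where "L = {v :: real ^ 'n. \<forall>i. c $ i = 0 \<longrightarrow> v $ i = 0}"
  have dim_L: "dim L = card {i. c $ i \<noteq> 0}"
    using dim_substandard_cart[of "{i. c $ i \<noteq> 0}", where 'a = real]
    by (simp add: L_def dim_vec_eq)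
  have "dim {v \<in> L. orthogonal c v} + dim {c} = dim L"
    by (rule dim_subspace_orthogonal_to_vector) (auto simp: L_def subspace_def)
  moreover have "dim {c} = (if c = 0 then 0 else 1)"
    by simp
  moreover have "card {i. c $ i \<noteq> 0} = 0" if "c = 0"
    using that by simp
  ultimately have "dim {v \<in> L. orthogonal c v} = card {i. c $ i \<noteq> 0} - 1"
    using dim_L by (auto split: if_splits)
  then show ?thesis
    by (simp add: L_def)
qed

lemma Gamma_form_eq_sum:
  "Gamma_form w \<mu> f g x = 1 / 2 * (\<Sum>y\<in>UNIV. w x y / \<mu> x * ((f y - f x) * (g y - g x)))"
proof -
  have "laplacian w \<mu> (\<lambda>y. f y * g y) x - f x * laplacian w \<mu> g x - g x * laplacian w \<mu> f x
      = (\<Sum>y\<in>UNIV. w x y / \<mu> x * (f y * g y - f x * g x)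
          - f x * (w x y / \<mu> x * (g y - g x)) - g x * (w x y / \<mu> x * (f y - f x)))"
    by (simp only: laplacian_def sum_distrib_left sum_subtractf)
  also have "\<dots> = (\<Sum>y\<in>UNIV. w x y / \<mu> x * ((f y - f x) * (g y - g x)))"
    by (intro sum.cong refl) algebra
  finally show ?thesis
    by (simp only: Gamma_form_def)
qed

definition closed_one_forms :: "('v::finite \<Rightarrow> 'v \<Rightarrow> real) \<Rightarrow> (real ^ 'v ^ 'v) set" where
  "closed_one_forms w = {\<alpha> \<in> one_forms w. \<forall>c\<in>path_2cells w. coboundary \<alpha> c = 0}"

lemma H1_path_iff:
  "\<alpha> \<in> H1_path w \<mu> \<longleftrightarrow> \<alpha> \<in> closed_one_forms w \<and> (\<forall>x. codifferential w \<mu> \<alpha> x = 0)"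
  by (auto simp: H1_path_def closed_one_forms_def)

lemma closed_one_forms_imp_one_forms: "\<alpha> \<in> closed_one_forms w \<Longrightarrow> \<alpha> \<in> one_forms w"
  by (simp add: closed_one_forms_def)

lemma one_forms_nonadj: "\<alpha> \<in> one_forms w \<Longrightarrow> \<not> adj w x y \<Longrightarrow> \<alpha> $ x $ y = 0"
  by (simp add: one_forms_def)

lemma H1_path_nonadj: "\<alpha> \<in> H1_path w \<mu> \<Longrightarrow> \<not> adj w x y \<Longrightarrow> \<alpha> $ x $ y = 0"
  by (auto simp: H1_path_iff intro: one_forms_nonadj closed_one_forms_imp_one_forms)

context weighted_graph
begin

lemma adj_commute: "adj w x y \<longleftrightarrow> adj w y x"
  by (simp add: adj_def w_sym)

lemma reflclp_adj_commute: "(adj w)\<^sup>=\<^sup>= x y \<longleftrightarrow> (adj w)\<^sup>=\<^sup>= y x"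
  by (auto simp: adj_commute[of x y])

lemma not_adj_self: "\<not> adj w x x"
  by (simp add: adj_def w_diag)

lemma weight_eq_0_iff: "w x y = 0 \<longleftrightarrow> \<not> adj w x y"
  using w_nonneg[of x y] by (auto simp: adj_def)

lemma neighbour_sum_cong:
  assumes "\<And>y. adj w x y \<Longrightarrow> F y = G y"
  shows "(\<Sum>y\<in>UNIV. w x y / \<mu> x * F y) = (\<Sum>y\<in>UNIV. w x y / \<mu> x * G y)"
proof (intro sum.cong refl)
  show "w x y / \<mu> x * F y = w x y / \<mu> x * G y" for y
    using assms by (cases "adj w x y") (auto simp: weight_eq_0_iff)
qed

lemma neighbour_term_nonneg:
  assumes "adj w x y \<Longrightarrow> 0 \<le> r"
  shows "0 \<le> w x y / \<mu> x * r"
  using assms w_nonneg[of x y] \<mu>_pos[of x] weight_eq_0_iff[of x y] by (cases "adj w x y") auto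

lemma neighbour_sum_nonneg:
  assumes "\<And>y. adj w x y \<Longrightarrow> 0 \<le> F y"
  shows "0 \<le> (\<Sum>y\<in>UNIV. w x y / \<mu> x * F y)"
  using assms by (intro sum_nonneg neighbour_term_nonneg)

lemma neighbour_sum_eq_0_iff:
  assumes "\<And>y. adj w x y \<Longrightarrow> 0 \<le> F y"
  shows "(\<Sum>y\<in>UNIV. w x y / \<mu> x * F y) = 0 \<longleftrightarrow> (\<forall>y. adj w x y \<longrightarrow> F y = 0)"
proof -
  have "(\<Sum>y\<in>UNIV. w x y / \<mu> x * F y) = 0 \<longleftrightarrow> (\<forall>y\<in>UNIV. w x y / \<mu> x * F y = 0)"
    using assms by (intro sum_nonneg_eq_0_iff neighbour_term_nonneg) auto
  then show ?thesis
    using \<mu>_pos[of x] by (auto simp: weight_eq_0_iff)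
qed

lemma laplacian_cong:
  assumes "f x = g x" "\<And>y. adj w x y \<Longrightarrow> f y = g y"
  shows "laplacian w \<mu> f x = laplacian w \<mu> g x"
  unfolding laplacian_def using assms by (intro neighbour_sum_cong) simp

lemma Gamma_form_nonneg: "0 \<le> Gamma_form w \<mu> f f x"
  unfolding Gamma_form_eq_sum by (intro mult_nonneg_nonneg[of "1 / 2"] neighbour_sum_nonneg) auto

lemma Gamma_form_eq_0_if_locally_constant:
  assumes "\<And>y. adj w x y \<Longrightarrow> g y = g x"
  shows "Gamma_form w \<mu> f g x = 0"
  unfolding Gamma_form_eq_sum
  using neighbour_sum_cong[of x "\<lambda>y. (f y - f x) * (g y - g x)" "\<lambda>_. 0"] assms by simp

lemma CD_mono:
  assumes "CD w \<mu> K N x" "K' \<le> K" "0 < N" "N \<le> N'"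
  shows "CD w \<mu> K' N' x"
  unfolding CD_def
proof
  fix f
  have "real_of_ereal (1 / N') \<le> real_of_ereal (1 / N)"
    using assms(3,4) by (cases N; cases N') (auto simp: one_ereal_def frac_le)
  then have "real_of_ereal (1 / N') * (laplacian w \<mu> f x)\<^sup>2 + K' * Gamma_form w \<mu> f f x
      \<le> real_of_ereal (1 / N) * (laplacian w \<mu> f x)\<^sup>2 + K * Gamma_form w \<mu> f f x"
    using assms(2) Gamma_form_nonneg by (intro add_mono mult_right_mono) auto
  also have "\<dots> \<le> Gamma2_form w \<mu> f f x"
    using assms(1) by (simp add: CD_def)
  finally show "real_of_ereal (1 / N') * (laplacian w \<mu> f x)\<^sup>2 + K' * Gamma_form w \<mu> f f x
      \<le> Gamma2_form w \<mu> f f x" .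
qed

lemma nonneg_BE_curvature_iff_CD: "nonneg_BE_curvature w \<mu> \<longleftrightarrow> (\<forall>x. CD w \<mu> 0 \<infinity> x)"
  unfolding nonneg_BE_curvature_def
proof (intro iffI allI)
  show "CD w \<mu> 0 \<infinity> x" if "\<exists>K N. K \<ge> 0 \<and> N > 0 \<and> (\<forall>x. CD w \<mu> K N x)" for x
    using that by (auto intro: CD_mono)
next
  show "\<exists>K N. K \<ge> 0 \<and> N > 0 \<and> (\<forall>x. CD w \<mu> K N x)" if "\<forall>x. CD w \<mu> 0 \<infinity> x"
    using that by (intro exI[of _ 0] exI[of _ \<infinity>]) simp
qed

lemma one_forms_antisym:
  assumes \<alpha>: "\<alpha> \<in> one_forms w"
  shows "\<alpha> $ x $ y = - \<alpha> $ y $ x"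
proof (cases "adj w x y")
  case True
  then show ?thesis
    using \<alpha> unfolding one_forms_def by blast
next
  case False
  then show ?thesis
    using \<alpha> adj_commute by (simp add: one_forms_nonadj)
qed

lemma one_forms_diag: "\<alpha> \<in> one_forms w \<Longrightarrow> \<alpha> $ x $ x = 0"
  by (simp add: one_forms_nonadj not_adj_self)

text \<open>Closed walks are allowed to pause at a vertex, so that the potential below needs no case
  distinction on the distance from its centre.\<close>

lemma closed_one_forms_triangle:
  assumes \<alpha>: "\<alpha> \<in> closed_one_forms w"
    and adj: "(adj w)\<^sup>=\<^sup>= x y" "(adj w)\<^sup>=\<^sup>= y z" "(adj w)\<^sup>=\<^sup>= z x"
  shows "\<alpha> $ x $ y + \<alpha> $ y $ z + \<alpha> $ z $ x = 0"
proof (cases "distinct [x, y, z]")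
  case True
  then have "[x, y, z] \<in> path_2cells w"
    using adj by (auto simp: path_2cells_def less_Suc_eq)
  then have "coboundary \<alpha> [x, y, z] = 0"
    using \<alpha> by (simp add: closed_one_forms_def)
  then show ?thesis
    by (simp add: coboundary_def)
next
  case False
  note antisym = one_forms_antisym[OF closed_one_forms_imp_one_forms[OF \<alpha>]]
    and diag = one_forms_diag[OF closed_one_forms_imp_one_forms[OF \<alpha>]]
  consider "x = y" | "y = z" | "z = x"
    using False by auto
  then show ?thesis
    using antisym[of x y] antisym[of y z] antisym[of z x] diag[of x] diag[of y] diag[of z]
    by cases (hypsubst, linarith)+
qed

lemma closed_one_forms_square:
  assumes \<alpha>: "\<alpha> \<in> closed_one_forms w"
    and adj: "(adj w)\<^sup>=\<^sup>= x y" "(adj w)\<^sup>=\<^sup>= y z" "(adj w)\<^sup>=\<^sup>= z u" "(adj w)\<^sup>=\<^sup>= u x"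
  shows "\<alpha> $ x $ y + \<alpha> $ y $ z + \<alpha> $ z $ u + \<alpha> $ u $ x = 0"
proof -
  note antisym = one_forms_antisym[OF closed_one_forms_imp_one_forms[OF \<alpha>]]
    and diag = one_forms_diag[OF closed_one_forms_imp_one_forms[OF \<alpha>]]
  note triangle = closed_one_forms_triangle[OF \<alpha>]
  consider (cycle) "distinct [x, y, z, u]" | (backtrack_z) "x = z" | (backtrack_u) "y = u"
    | (pause_y) "x = y \<or> y = z" | (pause_u) "z = u \<or> u = x"
    by auto
  then show ?thesis
  proof cases
    case cycle
    then have "[x, y, z, u] \<in> path_2cells w"
      using adj by (auto simp: path_2cells_def less_Suc_eq)
    then have "coboundary \<alpha> [x, y, z, u] = 0"
      using \<alpha> by (simp add: closed_one_forms_def)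
    then show ?thesis
      by (simp add: coboundary_def)
  next
    case backtrack_z
    then show ?thesis
      using antisym[of x y] antisym[of z u] by simp
  next
    case backtrack_u
    then show ?thesis
      using antisym[of x y] antisym[of y z] by simp
  next
    case pause_y
    then show ?thesis
      using adj triangle[of x z u] by (auto simp: diag)
  next
    case pause_u
    then show ?thesis
      using adj triangle[of x y z] by (auto simp: diag)
  qed
qed

definition local_potential :: "('v \<Rightarrow> real) \<Rightarrow> real ^ 'v ^ 'v \<Rightarrow> 'v \<Rightarrow> bool" where
  "local_potential f \<alpha> x \<longleftrightarrow> (\<forall>y z. (adj w)\<^sup>=\<^sup>= x y \<longrightarrow> adj w y z \<longrightarrow> f z - f y = \<alpha> $ y $ z)"

lemma local_potentialD:
  "local_potential f \<alpha> x \<Longrightarrow> (adj w)\<^sup>=\<^sup>= x y \<Longrightarrow> adj w y z \<Longrightarrow> f z - f y = \<alpha> $ y $ z"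
  unfolding local_potential_def by blast

lemma closed_one_forms_local_potential:
  assumes \<alpha>: "\<alpha> \<in> closed_one_forms w"
  obtains f where "local_potential f \<alpha> x"
proof -
  define via where "via z = (SOME y. (adj w)\<^sup>=\<^sup>= x y \<and> (adj w)\<^sup>=\<^sup>= y z)" for z
  define f where "f z = \<alpha> $ x $ via z + \<alpha> $ via z $ z" for z
  note \<alpha>_form = closed_one_forms_imp_one_forms[OF \<alpha>]
  have f_eq: "f z = \<alpha> $ x $ y + \<alpha> $ y $ z" if y: "(adj w)\<^sup>=\<^sup>= x y" "(adj w)\<^sup>=\<^sup>= y z" for y z
  proof -
    have "(adj w)\<^sup>=\<^sup>= x (via z) \<and> (adj w)\<^sup>=\<^sup>= (via z) z"
      unfolding via_def by (rule someI[of _ y]) (use y in simp)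
    then have "(adj w)\<^sup>=\<^sup>= z (via z)" "(adj w)\<^sup>=\<^sup>= (via z) x"
      using reflclp_adj_commute by blast+
    then have "\<alpha> $ x $ y + \<alpha> $ y $ z + \<alpha> $ z $ via z + \<alpha> $ via z $ x = 0"
      using closed_one_forms_square[OF \<alpha> y] by blast
    then show ?thesis
      using one_forms_antisym[OF \<alpha>_form, of z "via z"] one_forms_antisym[OF \<alpha>_form, of "via z" x]
      by (simp add: f_def)
  qed
  have "f z - f y = \<alpha> $ y $ z" if "(adj w)\<^sup>=\<^sup>= x y" "adj w y z" for y z
    using f_eq[of y z] f_eq[of x y] that one_forms_diag[OF \<alpha>_form] by simp
  then have "local_potential f \<alpha> x"
    unfolding local_potential_def by blast
  then show ?thesis
    by (rule that)
qed

definition energy :: "real ^ 'v ^ 'v \<Rightarrow> 'v \<Rightarrow> real" where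
  "energy \<alpha> x = 1 / 2 * (\<Sum>y\<in>UNIV. w x y / \<mu> x * (\<alpha> $ x $ y)\<^sup>2)"

lemma energy_eq_0_iff: "energy \<alpha> x = 0 \<longleftrightarrow> (\<forall>y. adj w x y \<longrightarrow> \<alpha> $ x $ y = 0)"
  unfolding energy_def using neighbour_sum_eq_0_iff[of x "\<lambda>y. (\<alpha> $ x $ y)\<^sup>2"] by simp

lemma local_potential_laplacian:
  assumes "local_potential f \<alpha> x" "(adj w)\<^sup>=\<^sup>= x y"
  shows "laplacian w \<mu> f y = codifferential w \<mu> \<alpha> y"
  unfolding laplacian_def codifferential_def
  using assms by (intro neighbour_sum_cong local_potentialD)

lemma local_potential_Gamma_form:
  assumes "local_potential f \<alpha> x" "(adj w)\<^sup>=\<^sup>= x y"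
  shows "Gamma_form w \<mu> f f y = energy \<alpha> y"
  unfolding Gamma_form_eq_sum energy_def using assms
  by (intro arg_cong[where f = "(*) (1 / 2)"] neighbour_sum_cong)
     (simp only: local_potentialD power2_eq_square)

lemma local_potential_Gamma2_form:
  assumes f: "local_potential f \<alpha> x"
    and coclosed: "\<And>y. adj w x y \<Longrightarrow> codifferential w \<mu> \<alpha> y = codifferential w \<mu> \<alpha> x"
  shows "Gamma2_form w \<mu> f f x = 1 / 2 * laplacian w \<mu> (energy \<alpha>) x"
proof -
  have "Gamma_form w \<mu> f (laplacian w \<mu> f) x = 0"
    using local_potential_laplacian[OF f] coclosed
    by (intro Gamma_form_eq_0_if_locally_constant) simp
  moreover have "laplacian w \<mu> (Gamma_form w \<mu> f f) x = laplacian w \<mu> (energy \<alpha>) x"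
    using local_potential_Gamma_form[OF f] by (intro laplacian_cong) simp_all
  ultimately show ?thesis
    by (simp add: Gamma2_form_def)
qed

lemma energy_subharmonic:
  assumes "CD w \<mu> 0 \<infinity> x" and \<alpha>: "\<alpha> \<in> H1_path w \<mu>"
  shows "0 \<le> laplacian w \<mu> (energy \<alpha>) x"
proof -
  obtain f where "local_potential f \<alpha> x"
    using \<alpha> closed_one_forms_local_potential by (auto simp: H1_path_iff)
  then have "Gamma2_form w \<mu> f f x = 1 / 2 * laplacian w \<mu> (energy \<alpha>) x"
    using \<alpha> by (intro local_potential_Gamma2_form) (simp_all add: H1_path_iff)
  moreover have "0 \<le> Gamma2_form w \<mu> f f x"
    using assms(1) by (simp add: CD_def)
  ultimately show ?thesis
    by simp
qed

lemma subharmonic_eq_at_local_max: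
  assumes sub: "0 \<le> laplacian w \<mu> u x" and max: "\<And>y. adj w x y \<Longrightarrow> u y \<le> u x"
    and z: "adj w x z"
  shows "u z = u x"
proof -
  have lap: "(\<Sum>y\<in>UNIV. w x y / \<mu> x * (u x - u y)) = - laplacian w \<mu> u x"
    by (simp only: laplacian_def sum_negf[symmetric] mult_minus_right[symmetric] minus_diff_eq)
  have "0 \<le> (\<Sum>y\<in>UNIV. w x y / \<mu> x * (u x - u y))"
    using max by (intro neighbour_sum_nonneg) simp
  then have "(\<Sum>y\<in>UNIV. w x y / \<mu> x * (u x - u y)) = 0"
    using lap sub by simp
  then show ?thesis
    using max z by (subst (asm) neighbour_sum_eq_0_iff) auto
qed

lemma subharmonic_constant:
  assumes conn: "graph_connected w" and sub: "\<And>x. 0 \<le> laplacian w \<mu> u x"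
  shows "u x = u y"
proof -
  have "Max (range u) \<in> range u"
    by (rule Max_in) auto
  then obtain a where "u a = Max (range u)"
    by (metis rangeE)
  then have max: "u z \<le> u a" for z
    by simp
  have "u z = u a" for z
  proof -
    have "(adj w)\<^sup>*\<^sup>* a z"
      using conn by (simp add: graph_connected_def)
    then show ?thesis
    proof induction
      case (step y z)
      then show ?case
        using max subharmonic_eq_at_local_max[OF sub, of y z] by simp
    qed simp
  qed
  then show ?thesis
    by metis
qed

lemma H1_path_eq_0_if_row_eq_0:
  assumes conn: "graph_connected w" and curv: "nonneg_BE_curvature w \<mu>"
    and \<alpha>: "\<alpha> \<in> H1_path w \<mu>" and row: "\<alpha> $ x = 0"
  shows "\<alpha> = 0"
proof -
  have "\<alpha> $ y $ z = 0" for y z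
  proof (cases "adj w y z")
    case True
    have "energy \<alpha> y = energy \<alpha> x"
      using curv \<alpha> unfolding nonneg_BE_curvature_iff_CD
      by (intro subharmonic_constant[OF conn] energy_subharmonic) auto
    also have "\<dots> = 0"
      using row by (simp add: energy_eq_0_iff)
    finally show ?thesis
      using True by (simp add: energy_eq_0_iff)
  next
    case False
    then show ?thesis
      using \<alpha> by (simp add: H1_path_nonadj)
  qed
  then show ?thesis
    by (simp add: vec_eq_iff)
qed

lemma H1_path_orthogonal_weights:
  assumes \<alpha>: "\<alpha> \<in> H1_path w \<mu>"
  shows "orthogonal (\<chi> y. w x y) (\<alpha> $ x)"
proof -
  have "(\<Sum>y\<in>UNIV. w x y * \<alpha> $ x $ y) / \<mu> x = codifferential w \<mu> \<alpha> x"
    by (simp add: codifferential_def sum_divide_distrib)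
  also have "\<dots> = 0"
    using \<alpha> by (simp add: H1_path_iff)
  finally show ?thesis
    using \<mu>_pos[of x] by (simp add: orthogonal_def inner_vec_def)
qed

lemma dim_H1_path_le:
  assumes "graph_connected w" "nonneg_BE_curvature w \<mu>"
  shows "dim (H1_path w \<mu>) \<le> vdeg w x - 1"
proof -
  define row_at_x where "row_at_x = (\<lambda>\<alpha> :: real ^ 'v ^ 'v. \<alpha> $ x)"
  define W where "W = (\<chi> y. w x y)"
  have lin: "linear row_at_x"
    unfolding row_at_x_def by (intro bounded_linear.linear bounded_linear_vec_nth)
  have "inj_on row_at_x (H1_path w \<mu>)"
    unfolding linear_injective_on_subspace_0[OF lin subspace_H1_path]
    using H1_path_eq_0_if_row_eq_0[OF assms] by (auto simp: row_at_x_def)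
  then have "dim (H1_path w \<mu>) = dim (row_at_x ` H1_path w \<mu>)"
    using dim_image_eq[OF lin] subspace_H1_path by (metis span_eq_iff)
  also have "\<dots> \<le> dim {v. (\<forall>y. W $ y = 0 \<longrightarrow> v $ y = 0) \<and> orthogonal W v}"
    using H1_path_nonadj H1_path_orthogonal_weights
    by (intro dim_subset) (auto simp: row_at_x_def W_def weight_eq_0_iff)
  also have "\<dots> = card {y. W $ y \<noteq> 0} - 1"
    by (rule dim_orthogonal_in_support)
  also have "{y. W $ y \<noteq> 0} = {y. adj w y x}"
    by (auto simp: W_def weight_eq_0_iff adj_commute)
  finally show ?thesis
    by (simp add: vdeg_def)
qed

end

theorem theorem3p9:
  fixes w :: "'v::finite \<Rightarrow> 'v \<Rightarrow> real" and \<mu> :: "'v \<Rightarrow> real"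
  assumes "weighted_graph w \<mu>"
    and "graph_connected w"
    and "nonneg_BE_curvature w \<mu>"
  shows "betti1_path w \<mu> \<le> deg_min w - 1"
proof -
  interpret weighted_graph w \<mu>
    by fact
  have "deg_min w \<in> range (vdeg w)"
    unfolding deg_min_def by (rule Min_in) auto
  then obtain x where "deg_min w = vdeg w x"
    by auto
  then show ?thesis
    using dim_H1_path_le[OF assms(2,3), of x] by (simp add: betti1_path_def)
qed

end
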